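(* For every nonnegative integer $s$, the number $M_4(s)$ of $4\times 4$ magic squares with magic sum $s$ is $$M_4(s)=\begin{cases}\frac{1}{480}s^7+\frac{7}{240}s^6+\frac{89}{480}s^5+\frac{11}{16}s^4+\frac{779}{480}s^3+\frac{593}{240}s^2+\frac{1051}{480}s+\frac{13}{16}, & s\text{ odd},\\[4pt] \frac{1}{480}s^7+\frac{7}{240}s^6+\frac{89}{480}s^5+\frac{11}{16}s^4+\frac{49}{30}s^3+\frac{38}{15}s^2+\frac{71}{30}s+1, & s\text{ even}.\end{cases}$$
   Context: A magic square is a square matrix whose entries are nonnegative integers (not required to be distinct) such that the sum of the entries in every row, in every column, and in each of the two main diagonals is the same number, called the magic sum. *)

theory Defs
  imports Complex_Main "Jordan_Normal_Form.Matrix"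
begin

text \<open>
  Rows and columns are indexed from 0, so the second main diagonal of an
  \<open>n\<close> by \<open>n\<close> matrix consists of the positions \<open>(i, n - 1 - i)\<close>.
\<close>

definition magic_square :: "nat \<Rightarrow> nat \<Rightarrow> nat mat \<Rightarrow> bool" where
  "magic_square n s A \<longleftrightarrow>
     A \<in> carrier_mat n n \<and>
     (\<forall>i<n. (\<Sum>j<n. A $$ (i, j)) = s) \<and>
     (\<forall>j<n. (\<Sum>i<n. A $$ (i, j)) = s) \<and>
     (\<Sum>i<n. A $$ (i, i)) = s \<and>
     (\<Sum>i<n. A $$ (i, n - 1 - i)) = s"

definition magic_count :: "nat \<Rightarrow> nat \<Rightarrow> nat" where
  "magic_count n s = card {A. magic_square n s A}"

end

theory Submission imports Defs begin

text \<open>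
  In a magic square of order 4 and sum s, the corners, the inner block and the two remaining
  groups of four cells each have sum s. Let r be the sum of the first and last corner on the main
  diagonal and t = s - r. The corner block and the inner block are then given by two lattice points
  of the rectangle [0, r] by [0, t], and each of the other two groups is a 2 by 2 table with given
  margins, which has one degree of freedom: the minimum (i, respectively j) of two opposite cells.
  The inequalities on both points are the same: they cut the corners of the rectangle, two opposite
  ones at size i and the other two at size j, so the count is the sum over r, i, j of the
  squared number of lattice points of an octagon.

  Passing from (t, i, j) to (t + 2, i + 1, j + 1) adds just two boundary rows to the octagon, so
  the sum over i and j obeys a recursion in t with polynomial increments. As it is symmetric in r
  and t, the recursion determines it from three initial values, and it remains to sum a
  polynomial over r.
\<close>

section \<open>Lattice points of a rectangle with cut corners\<close>

text \<open>The parameter \<open>i\<close> cuts the corners \<open>(0, 0)\<close> and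
  \<open>(r, t)\<close>, and \<open>j\<close> cuts \<open>(r, 0)\<close> and \<open>(0, t)\<close>.
  All inequalities are written additively to avoid truncated subtraction.\<close>

definition octagon :: "nat \<Rightarrow> nat \<Rightarrow> nat \<Rightarrow> nat \<Rightarrow> (nat \<times> nat) set" where
  "octagon r t i j = {(x, y). x \<le> r \<and> y \<le> t \<and> i \<le> x + y \<and> x + y + i \<le> r + t \<and>
                              j + x \<le> r + y \<and> y + j \<le> t + x}"

abbreviation octagon_card :: "nat \<Rightarrow> nat \<Rightarrow> nat \<Rightarrow> nat \<Rightarrow> nat" where
  "octagon_card r t i j \<equiv> card (octagon r t i j)"

lemma finite_octagon [simp]: "finite (octagon r t i j)"
  by (rule finite_subset [of _ "{..r} \<times> {..t}"]) (auto simp: octagon_def)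

lemma octagon_card_swap: "octagon_card r t i j = octagon_card t r i j"
  by (rule bij_betw_same_card [of prod.swap], rule bij_betw_byWitness [where f' = prod.swap])
     (auto simp: octagon_def)

lemma octagon_card_commute: "octagon_card r t i j = octagon_card r t j i"
  by (rule bij_betw_same_card [of "\<lambda>(x, y). (r - x, y)"],
      rule bij_betw_byWitness [where f' = "\<lambda>(x, y). (r - x, y)"])
     (auto simp: octagon_def)

text \<open>Rows 1 to \<open>t + 1\<close> of the larger octagon are a translate of the smaller one,
  because all four cuts move with the shift; only rows 0 and \<open>t + 2\<close> are new. The
  bounds on \<open>i\<close> and \<open>j\<close> keep the cuts at the far side from reaching these
  two rows.\<close>

lemma octagon_card_step:
  assumes "i \<le> t + 2" "j \<le> t + 2"
  shows "octagon_card r (t + 2) (i + 1) (j + 1) = octagon_card r t i j + 2 * (r - 1 - i - j)"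
proof -
  let ?inner = "(\<lambda>(x, y). (x, y + 1)) ` octagon r t i j"
  let ?bottom = "(\<lambda>x. (x, 0)) ` {i + 1..<r - j}"
  let ?top = "(\<lambda>x. (x, t + 2)) ` {j + 1..<r - i}"
  have "octagon r (t + 2) (i + 1) (j + 1) = ?inner \<union> (?bottom \<union> ?top)" (is "?L = ?R")
  proof
    show "?L \<subseteq> ?R"
    proof
      fix p assume p: "p \<in> ?L"
      obtain x y where xy: "p = (x, y)" by force
      consider "y = 0" | "y = t + 2" | y' where "y = y' + 1" "y' \<le> t"
        using p xy by (cases y) (force simp: octagon_def)+
      then show "p \<in> ?R"
        using p xy by cases (auto simp: octagon_def image_iff)
    qed
    show "?R \<subseteq> ?L" using assms by (auto simp: octagon_def)
  qed
  moreover have "?inner \<inter> (?bottom \<union> ?top) = {}" "?bottom \<inter> ?top = {}"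
    by (auto simp: octagon_def)
  moreover have "card ?inner = octagon_card r t i j"
    by (intro card_image) (auto simp: inj_on_def)
  moreover have "card ?bottom = r - 1 - i - j" "card ?top = r - 1 - i - j"
    by (subst card_image; simp add: inj_on_def)+
  ultimately show ?thesis
    by (simp add: card_Un_disjoint)
qed

text \<open>Truncation removes the terms with \<open>x \<ge> i\<close>, so the sum is a triangular
  number: the number of points cut off at one corner.\<close>

lemma sum_trunc_diff: "i \<le> r + 1 \<Longrightarrow> 2 * (\<Sum>x\<le>r. i - x) = i * (i + 1)" for i r :: nat
proof (induction r arbitrary: i)
  case (Suc r)
  show ?case
  proof (cases i)
    case (Suc k)
    then show ?thesis using Suc.IH [of k] Suc.prems
      by (simp only: sum.atMost_Suc_shift) (simp add: algebra_simps)
  qed simp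
qed auto

lemma sum_trunc_diff_rev: "(\<Sum>x\<le>r. i - (r - x)) = (\<Sum>x\<le>r. i - x)" for i r :: nat
  by (rule sum.reindex_bij_witness [of _ "\<lambda>x. r - x" "\<lambda>x. r - x"]) auto

lemma octagon_eq_Sigma:
  "octagon r t i j = (SIGMA x:{..r}. {y. (x, y) \<in> octagon r t i j})"
  by (auto simp: octagon_def)

text \<open>Under these bounds the four cut corners are pairwise disjoint triangles, two with
  \<open>i * (i + 1) / 2\<close> points and two with \<open>j * (j + 1) / 2\<close>.\<close>

lemma octagon_card_inner:
  assumes "i + j \<le> r" "2 * i \<le> r + t" "2 * j \<le> r + t" "i + j \<le> t + 1"
  shows "octagon_card r t i j + (i * (i + 1) + j * (j + 1)) = (r + 1) * (t + 1)"
proof -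
  let ?c = "\<lambda>x. ((i - x) + (j - (r - x))) + ((i - (r - x)) + (j - x))"
  have fibre: "card {y. (x, y) \<in> octagon r t i j} + ?c x = t + 1" if x: "x \<le> r" for x
  proof -
    \<comment> \<open>Since \<open>i + j \<le> r\<close>, at most one of the two cuts acts at each
      end of a column, so the maximum of the two truncated differences equals their sum.\<close>
    have low: "i \<le> x + y \<and> j + x \<le> r + y \<longleftrightarrow> (i - x) + (j - (r - x)) \<le> y" for y
      using assms x by linarith
    have high: "y \<le> t \<and> x + y + i \<le> r + t \<and> y + j \<le> t + x \<longleftrightarrow>
        y < t + 1 - ((i - (r - x)) + (j - x))" for y
      using assms x by linarith
    have "{y. (x, y) \<in> octagon r t i j} =
        {y. (i \<le> x + y \<and> j + x \<le> r + y) \<and> (y \<le> t \<and> x + y + i \<le> r + t \<and> y + j \<le> t + x)}"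
      using x by (auto simp: octagon_def)
    also have "\<dots> = {(i - x) + (j - (r - x))..<t + 1 - ((i - (r - x)) + (j - x))}"
      unfolding low high by auto
    finally have "{y. (x, y) \<in> octagon r t i j} =
        {(i - x) + (j - (r - x))..<t + 1 - ((i - (r - x)) + (j - x))}" .
    then have "card {y. (x, y) \<in> octagon r t i j} = t + 1 - ?c x" by (simp add: add.commute)
    moreover have "?c x \<le> t + 1" using assms x by linarith
    ultimately show ?thesis by simp
  qed
  have "octagon_card r t i j = (\<Sum>x\<le>r. card {y. (x, y) \<in> octagon r t i j})"
    by (subst octagon_eq_Sigma, subst card_SigmaI)
       (auto intro: finite_subset [of _ "{..t}"] simp: octagon_def)
  then have "octagon_card r t i j + (\<Sum>x\<le>r. ?c x) = (\<Sum>x\<le>r. t + 1)"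
    using fibre by (simp only: sum.distrib [symmetric]) simp
  moreover have "(\<Sum>x\<le>r. ?c x) = i * (i + 1) + j * (j + 1)"
    using sum_trunc_diff [of i r] sum_trunc_diff [of j r] assms
    unfolding sum.distrib sum_trunc_diff_rev by simp
  ultimately show ?thesis by simp
qed

text \<open>Once \<open>j\<close> reaches \<open>r\<close>, the two \<open>j\<close> cuts alone
  bound every column from below and above, and the region is a parallelogram with columns of equal
  length.\<close>

lemma octagon_card_outer:
  assumes "r \<le> j" "2 * j \<le> r + t"
  shows "octagon_card r t 0 j = (r + 1) * (r + t + 1 - 2 * j)"
proof -
  have "card {y. (x, y) \<in> octagon r t 0 j} = r + t + 1 - 2 * j" if x: "x \<le> r" for x
  proof -
    have "{y. (x, y) \<in> octagon r t 0 j} = {j + x - r..<t + x + 1 - j}"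
      using assms x by (auto simp: octagon_def)
    then show ?thesis using assms x by simp
  qed
  then show ?thesis
    by (subst octagon_eq_Sigma, subst card_SigmaI)
       (auto intro: finite_subset [of _ "{..t}"] simp: octagon_def)
qed

section \<open>Sums of squared octagon counts\<close>

text \<open>The range loses nothing: the octagon is empty as soon as \<open>2 * i\<close> or
  \<open>2 * j\<close> exceeds \<open>r + t\<close>.\<close>

definition slice :: "nat \<Rightarrow> nat \<Rightarrow> nat" where
  "slice r t = (\<Sum>i\<le>(r + t) div 2. \<Sum>j\<le>(r + t) div 2. (octagon_card r t i j)\<^sup>2)"

lemma slice_commute: "slice r t = slice t r"
  unfolding slice_def by (simp add: add.commute octagon_card_swap [of r t])

lemma real_octagon_card_inner:
  assumes "i + j \<le> r" "2 * i \<le> r + t" "2 * j \<le> r + t" "i + j \<le> t + 1"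
  shows "real (octagon_card r t i j) =
    (real r + 1) * (real t + 1) - real i * (real i + 1) - real j * (real j + 1)"
  using arg_cong [OF octagon_card_inner [OF assms], of real] by (simp add: algebra_simps)

section \<open>Polynomial sums over a triangle and along an edge\<close>

text \<open>The limit \<open>m\<close> is kept apart from \<open>k\<close> so that induction on
  \<open>m\<close> leaves the summand fixed; \<open>sum_triangle\<close> then takes both equal to
  \<open>K - i\<close>. The next lemma separates \<open>m\<close> from \<open>K\<close> for the same
  reason.\<close>

lemma sum_triangle_row:
  fixes k c :: real
  shows "(\<Sum>j<m. 4 * (k - real j) * (c - real j * (real j + 1) + (k - real j))) =
    (4 * m + 16 * m * k + 12 * m * k^2 - 9 * m^2 - 12 * m^2 * k + 2 * m^3 - 4 * m^3 * k
      + 3 * m^4 + 6 * m * c + 12 * m * k * c - 6 * m^2 * c) / 3"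
  by (induction m) (simp_all add: field_simps power2_eq_square power3_eq_cube power4_eq_xxxx)

lemma sum_triangle_rows:
  fixes K c :: real
  shows "(\<Sum>i<m. (4 * (K - i) + 6 * (K - i) * (c - real i * (real i + 1)) + 7 * (K - i)^2
        + 6 * (K - i)^2 * (c - real i * (real i + 1)) + 2 * (K - i)^3 - (K - i)^4) / 3) =
    (22*m + 80*m*K + 55*m*K^2 - 5*m*K^4 - 45*m^2 - 60*m^2*K + 10*m^2*K^3 + 15*m^3 - 20*m^3*K
      - 20*m^3*K^2 + 15*m^4 + 20*m^4*K - 7*m^5 + 20*m*c + 60*m*K*c + 30*m*K^2*c - 30*m^2*c
      - 30*m^2*K*c + 10*m^3*c) / 15"
  by (induction m) (simp_all add: field_simps eval_nat_numeral)

text \<open>With \<open>K = r - 1\<close> and \<open>c = (r + 1) * (t + 1)\<close> this is the total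
  increase of the squared counts caused by the two boundary rows.\<close>

lemma sum_triangle:
  fixes c :: real
  shows "(\<Sum>i<K. \<Sum>j<K - i. 4 * (real K - real i - real j) *
        (c - real i * (real i + 1) - real j * (real j + 1) + (real K - real i - real j))) =
    (22*K + 20*K*c + 35*K^2 + 30*K^2*c + 10*K^3 + 10*K^3*c - 5*K^4 - 2*K^5) / 15" (is "?lhs = ?rhs")
proof -
  have "(\<Sum>j<K - i. 4 * (real K - real i - real j) *
        (c - real i * (real i + 1) - real j * (real j + 1) + (real K - real i - real j))) =
      (4 * (real K - i) + 6 * (real K - i) * (c - real i * (real i + 1)) + 7 * (real K - i)^2
        + 6 * (real K - i)^2 * (c - real i * (real i + 1)) + 2 * (real K - i)^3 - (real K - i)^4) / 3"
    if "i < K" for i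
    unfolding sum_triangle_row using that
    by (simp add: of_nat_diff field_simps eval_nat_numeral)
  then have "?lhs = (\<Sum>i<K. (4 * (real K - i) + 6 * (real K - i) * (c - real i * (real i + 1))
      + 7 * (real K - i)^2 + 6 * (real K - i)^2 * (c - real i * (real i + 1))
      + 2 * (real K - i)^3 - (real K - i)^4) / 3)"
    by (intro sum.cong refl) simp
  also have "\<dots> = ?rhs"
    unfolding sum_triangle_rows by (simp add: field_simps eval_nat_numeral)
  finally show ?thesis .
qed

lemma sum_edge_inner:
  fixes c :: real
  shows "(\<Sum>j<m. (c - real j * (real j + 1))^2) =
    (2*m + 10*m*c + 15*m*c^2 - 5*m^3 - 10*m^3*c + 3*m^5) / 15"
  by (induction m) (simp_all add: field_simps eval_nat_numeral)

text \<open>The bases of the squares run from \<open>p + 1\<close> down to 1 or 2 in steps of two.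
  Both parities give the same polynomial, so the induction advances by two.\<close>

lemma sum_edge_outer:
  "(\<Sum>k\<le>p div 2. (real p + 1 - 2 * real k)^2) = (real p + 1) * (real p + 2) * (real p + 3) / 6"
proof (induction p rule: induct_nat_012)
  case (ge2 p)
  have "(\<Sum>k\<le>Suc (Suc p) div 2. (real (Suc (Suc p)) + 1 - 2 * real k)^2) =
      (real p + 3)^2 + (\<Sum>k\<le>p div 2. (real (Suc (Suc p)) + 1 - 2 * real (Suc k))^2)"
    by (simp add: sum.atMost_Suc_shift add.commute del: sum.atMost_Suc)
  also have "(\<Sum>k\<le>p div 2. (real (Suc (Suc p)) + 1 - 2 * real (Suc k))^2) =
      (\<Sum>k\<le>p div 2. (real p + 1 - 2 * real k)^2)"
    by (intro sum.cong refl) (simp add: algebra_simps)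
  also have "\<dots> = (real p + 1) * (real p + 2) * (real p + 3) / 6"
    by (rule ge2)
  finally show ?case
    by (simp add: field_simps power2_eq_square)
qed simp_all

text \<open>The sum is split at \<open>j = r\<close>: below it the cut corners are disjoint, from
  there on the region is a parallelogram.\<close>

lemma sum_edge:
  assumes "r \<le> t"
  shows "(\<Sum>j\<le>(r + t) div 2. (real (octagon_card r t 0 j))\<^sup>2) =
    (\<Sum>j<r. ((real r + 1) * (real t + 1) - real j * (real j + 1))\<^sup>2) +
    (real r + 1)\<^sup>2 * ((real t - real r + 1) * (real t - real r + 2) * (real t - real r + 3) / 6)"
proof -
  have le: "r \<le> (r + t) div 2" using assms by simp
  then have "{..(r + t) div 2} = {..<r} \<union> {r..(r + t) div 2}" by auto
  then have "(\<Sum>j\<le>(r + t) div 2. (real (octagon_card r t 0 j))\<^sup>2) =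
      (\<Sum>j<r. (real (octagon_card r t 0 j))\<^sup>2) + (\<Sum>j=r..(r + t) div 2. (real (octagon_card r t 0 j))\<^sup>2)"
    by (simp add: sum.union_disjoint ivl_disj_int)
  also have "(\<Sum>j<r. (real (octagon_card r t 0 j))\<^sup>2) =
      (\<Sum>j<r. ((real r + 1) * (real t + 1) - real j * (real j + 1))\<^sup>2)"
    using assms by (intro sum.cong refl) (simp add: real_octagon_card_inner)
  also have "(\<Sum>j=r..(r + t) div 2. (real (octagon_card r t 0 j))\<^sup>2) =
      (\<Sum>k\<le>(t - r) div 2. (real r + 1)\<^sup>2 * (real (t - r) + 1 - 2 * real k)\<^sup>2)"
  proof (rule sum.reindex_bij_witness [of _ "\<lambda>k. r + k" "\<lambda>j. j - r"])
    fix j assume j: "j \<in> {r..(r + t) div 2}"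
    then have "r \<le> j" "2 * j \<le> r + t" by auto
    moreover from this have "r + t + 1 - 2 * j = t - r + 1 - 2 * (j - r)"
      "2 * (j - r) \<le> t - r + 1"
      using assms by linarith+
    ultimately have "octagon_card r t 0 j = (r + 1) * (t - r + 1 - 2 * (j - r))"
      "2 * (j - r) \<le> t - r + 1"
      by (simp_all only: octagon_card_outer)
    then have "real (octagon_card r t 0 j) = (real r + 1) * (real (t - r) + 1 - 2 * real (j - r))"
      by (simp only: of_nat_mult of_nat_add of_nat_diff of_nat_1 of_nat_numeral)
    then show "(real r + 1)\<^sup>2 * (real (t - r) + 1 - 2 * real (j - r))\<^sup>2 =
        (real (octagon_card r t 0 j))\<^sup>2"
      by (simp add: power_mult_distrib)
  qed (use assms in auto)
  also have "\<dots> = (real r + 1)\<^sup>2 *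
      ((real t - real r + 1) * (real t - real r + 2) * (real t - real r + 3) / 6)"
    unfolding sum_distrib_left [symmetric] sum_edge_outer using assms by (simp add: of_nat_diff)
  finally show ?thesis .
qed

section \<open>The recursion in \<open>t\<close> and its solution\<close>

text \<open>The pair \<open>(i, j)\<close> at \<open>t\<close> is matched with
  \<open>(i + 1, j + 1)\<close> at \<open>t + 2\<close>. The unmatched pairs form the edges
  \<open>i = 0\<close> and \<open>j = 0\<close>, which contribute equally and share the pair
  \<open>(0, 0)\<close>.\<close>

lemma slice_step:
  assumes "r \<le> t + 2"
  defines "c \<equiv> (real r + 1) * (real t + 1)"
  shows "real (slice r (t + 2)) = real (slice r t) +
    (\<Sum>i<r - 1. \<Sum>j<r - 1 - i. 4 * (real (r - 1) - real i - real j) *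
      (c - real i * (real i + 1) - real j * (real j + 1) + (real (r - 1) - real i - real j))) +
    2 * (\<Sum>j\<le>(r + (t + 2)) div 2. (real (octagon_card r (t + 2) 0 j))\<^sup>2)
     - (real (octagon_card r (t + 2) 0 0))\<^sup>2"
proof -
  define n where "n = (r + t) div 2"
  let ?f = "\<lambda>i j. (real (octagon_card r (t + 2) i j))\<^sup>2"
  let ?g = "\<lambda>i j. real (octagon_card r t i j)"
  let ?\<tau> = "\<lambda>i j. real (r - 1 - i - j)"
  have n: "(r + (t + 2)) div 2 = Suc n" "n \<le> t + 1" "r - 1 \<le> n"
    using assms(1) by (auto simp: n_def)
  have "real (slice r (t + 2)) = (\<Sum>i\<le>Suc n. \<Sum>j\<le>Suc n. ?f i j)"
    by (simp only: slice_def n(1) of_nat_sum of_nat_power)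
  also have "\<dots> = (\<Sum>j\<le>Suc n. ?f 0 j) + (\<Sum>i\<le>n. ?f (Suc i) 0) +
      (\<Sum>i\<le>n. \<Sum>j\<le>n. ?f (Suc i) (Suc j))"
    by (simp only: sum.atMost_Suc_shift [of _ n] sum.distrib)
  also have "(\<Sum>i\<le>n. ?f (Suc i) 0) = (\<Sum>j\<le>Suc n. ?f 0 j) - ?f 0 0"
    by (simp add: sum.atMost_Suc_shift octagon_card_commute [of _ _ "Suc _" 0] del: sum.atMost_Suc)
  also have "(\<Sum>i\<le>n. \<Sum>j\<le>n. ?f (Suc i) (Suc j)) =
      (\<Sum>i\<le>n. \<Sum>j\<le>n. (?g i j)\<^sup>2 + 4 * ?\<tau> i j * (?g i j + ?\<tau> i j))"
  proof (intro sum.cong refl)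
    fix i j assume "i \<in> {..n}" "j \<in> {..n}"
    then have "i \<le> t + 2" "j \<le> t + 2" using n(2) by auto
    from arg_cong [OF octagon_card_step [OF this, of r], of real]
    have "real (octagon_card r (t + 2) (Suc i) (Suc j)) = ?g i j + 2 * ?\<tau> i j"
      by (simp only: of_nat_add of_nat_mult of_nat_numeral Suc_eq_plus1)
    moreover have "(x + 2 * y)\<^sup>2 = x\<^sup>2 + 4 * y * (x + y)" for x y :: real
      by (simp add: power2_eq_square algebra_simps)
    ultimately show "?f (Suc i) (Suc j) = (?g i j)\<^sup>2 + 4 * ?\<tau> i j * (?g i j + ?\<tau> i j)"
      by simp
  qed
  also have "\<dots> = real (slice r t) + (\<Sum>i\<le>n. \<Sum>j\<le>n. 4 * ?\<tau> i j * (?g i j + ?\<tau> i j))"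
    by (simp add: slice_def sum.distrib n_def)
  \<comment> \<open>The truncated \<open>?\<tau>\<close> vanishes unless
    \<open>i + j < r - 1\<close>. This triangle fits into the range because
    \<open>r - 1 \<le> n\<close>, and on it the formula for disjoint corners applies.\<close>
  also have "(\<Sum>i\<le>n. \<Sum>j\<le>n. 4 * ?\<tau> i j * (?g i j + ?\<tau> i j)) =
      (\<Sum>i\<le>n. \<Sum>j<r - 1 - i. 4 * ?\<tau> i j * (?g i j + ?\<tau> i j))"
    using n(3) by (intro sum.cong sum.mono_neutral_right refl) auto
  also have "\<dots> = (\<Sum>i<r - 1. \<Sum>j<r - 1 - i. 4 * ?\<tau> i j * (?g i j + ?\<tau> i j))"
  proof (rule sum.mono_neutral_right)
    show "\<forall>i \<in> {..n} - {..<r - 1}. (\<Sum>j<r - 1 - i. 4 * ?\<tau> i j * (?g i j + ?\<tau> i j)) = 0"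
    proof
      fix i assume "i \<in> {..n} - {..<r - 1}"
      then have "r - 1 - i = 0" by auto
      then show "(\<Sum>j<r - 1 - i. 4 * ?\<tau> i j * (?g i j + ?\<tau> i j)) = 0"
        by (simp only: lessThan_0 sum.empty)
    qed
  qed (use n(3) in auto)
  also have "\<dots> = (\<Sum>i<r - 1. \<Sum>j<r - 1 - i. 4 * (real (r - 1) - real i - real j) *
      (c - real i * (real i + 1) - real j * (real j + 1) + (real (r - 1) - real i - real j)))"
  proof (intro sum.cong refl)
    fix i j assume ij: "i \<in> {..<r - 1}" "j \<in> {..<r - 1 - i}"
    then have "?\<tau> i j = real (r - 1) - real i - real j" by (auto simp: of_nat_diff)
    moreover have "?g i j = c - real i * (real i + 1) - real j * (real j + 1)"
      unfolding c_def using ij assms(1) by (intro real_octagon_card_inner) auto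
    ultimately show "4 * ?\<tau> i j * (?g i j + ?\<tau> i j) = 4 * (real (r - 1) - real i - real j) *
      (c - real i * (real i + 1) - real j * (real j + 1) + (real (r - 1) - real i - real j))"
      by simp
  qed
  finally show ?thesis unfolding n(1) by linarith
qed

text \<open>The arguments stand for \<open>r + 1\<close> and \<open>t + 1\<close>, the numbers of
  lattice points on the sides. The polynomial is not symmetric and is used for
  \<open>r \<le> t\<close>.\<close>

definition slice_poly :: "real \<Rightarrow> real \<Rightarrow> real" where
  "slice_poly R T = (24*R*T + 24*R^2 + 30*R^2*T^2 + 5*R^2*T^4 + 20*R^3*T + 20*R^3*T^3
     - 10*R^4 + 10*R^4*T^2 - 4*R^5*T + R^6) / 120"

lemma slice_step_poly:
  assumes "r \<le> t + 2"
  shows "real (slice r (t + 2)) - real (slice r t) =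
    slice_poly (real r + 1) (real t + 3) - slice_poly (real r + 1) (real t + 1)"
proof (cases r)
  \<comment> \<open>Here the truncated \<open>r - 1\<close> is 0, not -1, so this case is separate
    from the polynomial computation.\<close>
  case 0
  have "octagon_card 0 (t + 2) 0 0 = t + 3"
    using octagon_card_inner [of 0 0 0 "t + 2"] by simp
  then show ?thesis
    using slice_step [OF assms] sum_edge [OF assms] 0
    by (simp add: slice_poly_def field_simps eval_nat_numeral)
next
  case (Suc k)
  have "real (octagon_card r (t + 2) 0 0) = (real r + 1) * (real t + 3)"
    using real_octagon_card_inner [of 0 0 r "t + 2"] by simp
  then show ?thesis
    unfolding slice_step [OF assms] sum_edge [OF assms] sum_triangle sum_edge_inner
    by (simp add: Suc slice_poly_def field_simps eval_nat_numeral)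
qed

text \<open>The step from \<open>t\<close> to \<open>t + 2\<close> preserves the parity of
  \<open>r + t\<close>, and the parity term does not involve \<open>t\<close>, so it cancels in the
  recursion.\<close>

lemma slice_closed_form:
  "r \<le> t \<Longrightarrow> real (slice r t) = slice_poly (real r + 1) (real t + 1)
     - (if odd (r + t) then (real r + 1)\<^sup>2 / 8 else 0)"
proof (induction "r + t" arbitrary: r t rule: less_induct)
  case less
  show ?case
  proof (cases "t \<ge> 2")
    case True
    then obtain t' where t: "t = t' + 2" by (metis add.commute le_Suc_ex)
    \<comment> \<open>In the last two cases \<open>(r, t')\<close> lies just beyond the diagonal.
      The induction hypothesis is applied to the swapped pair, and that close to the diagonal the
      closed form takes the same value on both orders.\<close>
    consider "r \<le> t'" | "r = t' + 1" | "r = t' + 2" using less.prems t by linarith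
    then have "real (slice r t') = slice_poly (real r + 1) (real t' + 1)
        - (if odd (r + t) then (real r + 1)\<^sup>2 / 8 else 0)"
    proof cases
      case 1
      then show ?thesis using less.hyps [of r t'] t by simp
    next
      case 2
      then have "real (slice r t') = slice_poly (real t' + 1) (real r + 1) - (real t' + 1)\<^sup>2 / 8"
        using less.hyps [of t' r] t by (simp add: slice_commute)
      moreover have "slice_poly (real t' + 1) (real r + 1) - (real t' + 1)\<^sup>2 / 8 =
          slice_poly (real r + 1) (real t' + 1) - (real r + 1)\<^sup>2 / 8"
        unfolding 2 by (simp add: slice_poly_def field_simps eval_nat_numeral)
      moreover have "odd (r + t)" using 2 t by presburger
      ultimately show ?thesis by simp
    next
      case 3
      then have "real (slice r t') = slice_poly (real t' + 1) (real r + 1)"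
        using less.hyps [of t' r] t by (simp add: slice_commute)
      moreover have "slice_poly (real t' + 1) (real r + 1) = slice_poly (real r + 1) (real t' + 1)"
        unfolding 3 by (simp add: slice_poly_def field_simps eval_nat_numeral)
      moreover have "even (r + t)" using 3 t by presburger
      ultimately show ?thesis by simp
    qed
    then show ?thesis using slice_step_poly [of r t'] less.prems t by (simp add: algebra_simps)
  next
    case False
    then consider "r = 0" "t = 0" | "r = 0" "t = 1" | "r = 1" "t = 1"
      using less.prems by linarith
    then show ?thesis
    proof cases
      case 1
      then show ?thesis using octagon_card_inner [of 0 0 0 0]
        by (simp add: slice_def slice_poly_def)
    next
      case 2
      then show ?thesis using octagon_card_inner [of 0 0 0 1]
        by (simp add: slice_def slice_poly_def)
    next
      case 3
      \<comment> \<open>The cuts force both \<open>x + y = 1\<close> and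
        \<open>x = y\<close>.\<close>
      have "octagon 1 1 1 1 = {}" unfolding octagon_def by (auto, presburger)
      then show ?thesis
        using 3 octagon_card_inner [of 0 0 1 1] octagon_card_inner [of 0 1 1 1]
          octagon_card_inner [of 1 0 1 1]
        by (simp add: slice_def slice_poly_def)
    qed
  qed
qed

section \<open>Summation over \<open>r\<close>\<close>

lemma sum_slice_poly:
  "(\<Sum>r<m. slice_poly (real r + 1) (s - real r + 1)) =
    (360*m + 368*m*s + 154*m*s^2 + 40*m*s^3 + 5*m*s^4 + 608*m^2 + 844*m^2*s + 450*m^2*s^2
      + 120*m^2*s^3 + 15*m^2*s^4 + 280*m^3*s + 260*m^3*s^2 + 80*m^3*s^3 + 10*m^3*s^4 - 280*m^4
      - 260*m^4*s - 60*m^4*s^2 - 48*m^5*s - 24*m^5*s^2 + 32*m^6 + 16*m^6*s) / 720"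
  by (induction m) (simp_all add: slice_poly_def field_simps eval_nat_numeral)

lemma sum_symmetric_even:
  fixes h :: "nat \<Rightarrow> real"
  assumes "\<And>r. r \<le> 2 * n \<Longrightarrow> h (2 * n - r) = h r"
  shows "(\<Sum>r\<le>2 * n. h r) = 2 * (\<Sum>r<n. h r) + h n"
proof -
  have "{..2 * n} = insert n ({..<n} \<union> {n<..2 * n})" by auto
  moreover have "(\<Sum>r\<in>{n<..2 * n}. h r) = (\<Sum>r<n. h r)"
    by (rule sum.reindex_bij_witness [of _ "\<lambda>r. 2 * n - r" "\<lambda>r. 2 * n - r"]) (auto simp: assms)
  moreover have "{..<n} \<inter> {n<..2 * n} = {}" by auto
  ultimately show ?thesis
    by (simp add: sum.union_disjoint)
qed

lemma sum_symmetric_odd: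
  fixes h :: "nat \<Rightarrow> real"
  assumes "\<And>r. r \<le> 2 * n + 1 \<Longrightarrow> h (2 * n + 1 - r) = h r"
  shows "(\<Sum>r\<le>2 * n + 1. h r) = 2 * (\<Sum>r<n + 1. h r)"
proof -
  have "{..2 * n + 1} = {..<n + 1} \<union> {n<..2 * n + 1}" by auto
  moreover have "(\<Sum>r\<in>{n<..2 * n + 1}. h r) = (\<Sum>r<n + 1. h r)"
    by (rule sum.reindex_bij_witness [of _ "\<lambda>r. 2 * n + 1 - r" "\<lambda>r. 2 * n + 1 - r"])
       (use assms in auto)
  moreover have "{..<n + 1} \<inter> {n<..2 * n + 1} = {}" by auto
  ultimately show ?thesis
    by (simp only: sum.union_disjoint finite_lessThan finite_greaterThanAtMost mult_2)
qed

lemma sum_squares_Suc: "(\<Sum>r<m. (real r + 1)\<^sup>2) = m * (m + 1) * (2 * m + 1) / 6"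
  by (induction m) (simp_all add: field_simps power2_eq_square)

text \<open>The closed form requires \<open>r \<le> t\<close>, so the sum is folded by the symmetry
  of \<open>slice\<close>; the term \<open>r = n\<close> has no partner, and no parity term
  occurs.\<close>

lemma sum_slice_even:
  fixes n :: nat
  defines "s \<equiv> real (2 * n)"
  shows "real (\<Sum>r\<le>2 * n. slice r (2 * n - r)) =
    1/480 * s ^ 7 + 7/240 * s ^ 6 + 89/480 * s ^ 5 + 11/16 * s ^ 4
          + 49/30 * s ^ 3 + 38/15 * s ^ 2 + 71/30 * s + 1"
proof -
  have "real (\<Sum>r\<le>2 * n. slice r (2 * n - r)) =
      2 * (\<Sum>r<n. real (slice r (2 * n - r))) + real (slice n (2 * n - n))"
    unfolding of_nat_sum by (rule sum_symmetric_even) (simp add: slice_commute)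
  also have "(\<Sum>r<n. real (slice r (2 * n - r))) = (\<Sum>r<n. slice_poly (real r + 1) (s - real r + 1))"
    by (intro sum.cong refl) (simp add: slice_closed_form of_nat_diff s_def)
  also have "real (slice n (2 * n - n)) = slice_poly (real n + 1) (real n + 1)"
    by (simp add: slice_closed_form)
  finally show ?thesis
    unfolding sum_slice_poly s_def
    by (simp add: slice_poly_def field_simps eval_nat_numeral)
qed

text \<open>Now all terms pair up and each carries the parity term, which brings in the sum of
  squares.\<close>

lemma sum_slice_odd:
  fixes n :: nat
  defines "s \<equiv> real (2 * n + 1)"
  shows "real (\<Sum>r\<le>2 * n + 1. slice r (2 * n + 1 - r)) =
    1/480 * s ^ 7 + 7/240 * s ^ 6 + 89/480 * s ^ 5 + 11/16 * s ^ 4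
          + 779/480 * s ^ 3 + 593/240 * s ^ 2 + 1051/480 * s + 13/16"
proof -
  have "real (\<Sum>r\<le>2 * n + 1. slice r (2 * n + 1 - r)) =
      2 * (\<Sum>r<n + 1. real (slice r (2 * n + 1 - r)))"
    unfolding of_nat_sum by (rule sum_symmetric_odd) (simp add: slice_commute)
  also have "(\<Sum>r<n + 1. real (slice r (2 * n + 1 - r))) =
      (\<Sum>r<n + 1. slice_poly (real r + 1) (s - real r + 1) - (real r + 1)\<^sup>2 / 8)"
    by (intro sum.cong refl) (auto simp: slice_closed_form of_nat_diff s_def)
  finally show ?thesis
    unfolding sum_subtractf sum_divide_distrib [symmetric] sum_slice_poly sum_squares_Suc s_def
    by (simp add: field_simps eval_nat_numeral)
qed

section \<open>Magic squares of order 4 as pairs of lattice points\<close>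

lemma sum_lessThan_4: "(\<Sum>k<4::nat. f k) = f 0 + f 1 + f 2 + (f 3 :: nat)"
  by (simp add: eval_nat_numeral)

lemma all_less_4: "(\<forall>k<4. P k) \<longleftrightarrow> P 0 \<and> P 1 \<and> P 2 \<and> P (3 :: nat)"
  by (auto simp: eval_nat_numeral less_Suc_eq)

lemma magic_square_4_iff:
  "magic_square 4 s A \<longleftrightarrow> A \<in> carrier_mat 4 4 \<and>
     A $$ (0, 0) + A $$ (0, 1) + A $$ (0, 2) + A $$ (0, 3) = s \<and>
     A $$ (1, 0) + A $$ (1, 1) + A $$ (1, 2) + A $$ (1, 3) = s \<and>
     A $$ (2, 0) + A $$ (2, 1) + A $$ (2, 2) + A $$ (2, 3) = s \<and>
     A $$ (3, 0) + A $$ (3, 1) + A $$ (3, 2) + A $$ (3, 3) = s \<and>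
     A $$ (0, 0) + A $$ (1, 0) + A $$ (2, 0) + A $$ (3, 0) = s \<and>
     A $$ (0, 1) + A $$ (1, 1) + A $$ (2, 1) + A $$ (3, 1) = s \<and>
     A $$ (0, 2) + A $$ (1, 2) + A $$ (2, 2) + A $$ (3, 2) = s \<and>
     A $$ (0, 3) + A $$ (1, 3) + A $$ (2, 3) + A $$ (3, 3) = s \<and>
     A $$ (0, 0) + A $$ (1, 1) + A $$ (2, 2) + A $$ (3, 3) = s \<and>
     A $$ (0, 3) + A $$ (1, 2) + A $$ (2, 1) + A $$ (3, 0) = s"
  by (simp add: magic_square_def sum_lessThan_4 all_less_4)

lemma magic_square_4D:
  assumes "magic_square 4 s A"
  shows "A \<in> carrier_mat 4 4"
    "A $$ (0, 0) + A $$ (0, 1) + A $$ (0, 2) + A $$ (0, 3) = s"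
    "A $$ (1, 0) + A $$ (1, 1) + A $$ (1, 2) + A $$ (1, 3) = s"
    "A $$ (2, 0) + A $$ (2, 1) + A $$ (2, 2) + A $$ (2, 3) = s"
    "A $$ (3, 0) + A $$ (3, 1) + A $$ (3, 2) + A $$ (3, 3) = s"
    "A $$ (0, 0) + A $$ (1, 0) + A $$ (2, 0) + A $$ (3, 0) = s"
    "A $$ (0, 1) + A $$ (1, 1) + A $$ (2, 1) + A $$ (3, 1) = s"
    "A $$ (0, 2) + A $$ (1, 2) + A $$ (2, 2) + A $$ (3, 2) = s"
    "A $$ (0, 3) + A $$ (1, 3) + A $$ (2, 3) + A $$ (3, 3) = s"
    "A $$ (0, 0) + A $$ (1, 1) + A $$ (2, 2) + A $$ (3, 3) = s"
    "A $$ (0, 3) + A $$ (1, 2) + A $$ (2, 1) + A $$ (3, 0) = s"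
  using assms unfolding magic_square_4_iff by blast+

text \<open>Adding the outer rows to the middle columns and subtracting both diagonals counts the
  first group twice, with total \<open>2 * s\<close>; the second follows likewise from the middle
  rows and outer columns. Removing the first group from the outer rows leaves the corners, and from
  the middle columns the inner block.\<close>

lemma magic_square_4_block_sums:
  assumes "magic_square 4 s A"
  shows "A $$ (0, 1) + A $$ (0, 2) + A $$ (3, 1) + A $$ (3, 2) = s"
    and "A $$ (1, 0) + A $$ (1, 3) + A $$ (2, 0) + A $$ (2, 3) = s"
    and "A $$ (0, 0) + A $$ (0, 3) + A $$ (3, 0) + A $$ (3, 3) = s"
    and "A $$ (1, 1) + A $$ (1, 2) + A $$ (2, 1) + A $$ (2, 2) = s"
proof -
  show *: "A $$ (0, 1) + A $$ (0, 2) + A $$ (3, 1) + A $$ (3, 2) = s"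
    using magic_square_4D(2,5,7,8,10,11) [OF assms] by linarith
  show "A $$ (1, 0) + A $$ (1, 3) + A $$ (2, 0) + A $$ (2, 3) = s"
    using magic_square_4D(3,4,6,9,10,11) [OF assms] by linarith
  show "A $$ (0, 0) + A $$ (0, 3) + A $$ (3, 0) + A $$ (3, 3) = s"
    using * magic_square_4D(2,5) [OF assms] by linarith
  show "A $$ (1, 1) + A $$ (1, 2) + A $$ (2, 1) + A $$ (2, 2) = s"
    using * magic_square_4D(7,8) [OF assms] by linarith
qed

lemma diff_eqI: "m = n + k \<Longrightarrow> m - n = k" for m n k :: nat
  by simp

lemma eq_mat_4_iff:
  assumes "A \<in> carrier_mat 4 4" "B \<in> carrier_mat 4 4"
  shows "A = B \<longleftrightarrow> (\<forall>i<4. \<forall>j<4. A $$ (i, j) = B $$ (i, j))"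
  using assms by (metis carrier_matD eq_matI)

text \<open>The point (x, y) holds the cells (0, 0) and (0, 3), and (x', y') the cells (2, 1) and
  (1, 1); i is the minimum of the cells (0, 1) and (3, 2), and j that of
  the cells (1, 0) and (2, 3). One of the truncated differences in each pair vanishes.\<close>

definition square_of ::
  "nat \<Rightarrow> nat \<times> nat \<times> nat \<times> (nat \<times> nat) \<times> (nat \<times> nat) \<Rightarrow> nat mat" where
  "square_of s = (\<lambda>(r, i, j, (x, y), (x', y')).
     let a = i + (s - (x + y + x' + y')); b = j + ((y + x') - (x + y')) in
     mat 4 4 (\<lambda>(k, l).
       [[x, a, s - (x + y + a), y],
        [b, y', r - x', s + x' - (r + y' + b)],
        [r + y - (x + b), x', s - (r + y'), j + ((x + y') - (y + x'))],
        [s - (r + y), s - (x' + y' + a), i + (x + y + x' + y' - s), r - x]] ! k ! l))"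

definition params_of ::
  "nat mat \<Rightarrow> nat \<times> nat \<times> nat \<times> (nat \<times> nat) \<times> (nat \<times> nat)" where
  "params_of A = (A $$ (0, 0) + A $$ (3, 3), min (A $$ (0, 1)) (A $$ (3, 2)),
     min (A $$ (1, 0)) (A $$ (2, 3)), (A $$ (0, 0), A $$ (0, 3)), (A $$ (2, 1), A $$ (1, 1)))"

definition params :: "nat \<Rightarrow> (nat \<times> nat \<times> nat \<times> (nat \<times> nat) \<times> (nat \<times> nat)) set" where
  "params s = (SIGMA r:{..s}. SIGMA i:{..s div 2}. SIGMA j:{..s div 2}.
     octagon r (s - r) i j \<times> octagon r (s - r) i j)"

lemma square_of_params_of:
  assumes A: "magic_square 4 s A"
  shows "square_of s (params_of A) = A"
proof -
  note eqs = magic_square_4D(2,3,6,7,10) [OF A] magic_square_4_block_sums [OF A]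
  have c: "square_of s (params_of A) \<in> carrier_mat 4 4" "A \<in> carrier_mat 4 4"
    using magic_square_4D(1) [OF A] by (simp_all add: square_of_def params_of_def Let_def)
  \<comment> \<open>The margins of a 2 by 2 table fix the difference of two opposite cells: here
    \<open>s - Z\<close>, and \<open>U - V\<close> for the other table. Adding the truncated
    difference to the minimum restores each cell.\<close>
  define Z where "Z = A $$ (0, 0) + A $$ (0, 3) + A $$ (2, 1) + A $$ (1, 1)"
  have Z: "A $$ (3, 2) + s = A $$ (0, 1) + Z"
    using eqs(1,4,6) unfolding Z_def by linarith
  have a: "min (A $$ (0, 1)) (A $$ (3, 2)) + (s - Z) = A $$ (0, 1)"
    "min (A $$ (0, 1)) (A $$ (3, 2)) + (Z - s) = A $$ (3, 2)"
    using Z by linarith+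
  define U V where "U = A $$ (0, 3) + A $$ (2, 1)" and "V = A $$ (0, 0) + A $$ (1, 1)"
  have UV: "A $$ (2, 3) + U = A $$ (1, 0) + V"
    using eqs(2,3,5,7,8,9) unfolding U_def V_def by linarith
  have b: "min (A $$ (1, 0)) (A $$ (2, 3)) + (U - V) = A $$ (1, 0)"
    "min (A $$ (1, 0)) (A $$ (2, 3)) + (V - U) = A $$ (2, 3)"
    using UV by linarith+
  have rest: "s - (A $$ (0, 0) + A $$ (0, 3) + A $$ (0, 1)) = A $$ (0, 2)"
    "A $$ (0, 0) + A $$ (3, 3) - A $$ (2, 1) = A $$ (1, 2)"
    "s + A $$ (2, 1) - (A $$ (0, 0) + A $$ (3, 3) + A $$ (1, 1) + A $$ (1, 0)) = A $$ (1, 3)"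
    "A $$ (0, 0) + A $$ (3, 3) + A $$ (0, 3) - (A $$ (0, 0) + A $$ (1, 0)) = A $$ (2, 0)"
    "s - (A $$ (0, 0) + A $$ (3, 3) + A $$ (1, 1)) = A $$ (2, 2)"
    "s - (A $$ (0, 0) + A $$ (3, 3) + A $$ (0, 3)) = A $$ (3, 0)"
    "s - (A $$ (2, 1) + A $$ (1, 1) + A $$ (0, 1)) = A $$ (3, 1)"
    "A $$ (0, 0) + A $$ (3, 3) - A $$ (0, 0) = A $$ (3, 3)"
    by (rule diff_eqI; use eqs in linarith)+
  show ?thesis
    unfolding eq_mat_4_iff [OF c] all_less_4
    unfolding square_of_def params_of_def prod.case Let_def
    unfolding a [unfolded Z_def] b [unfolded U_def V_def] rest
    by (simp add: numeral_2_eq_2 numeral_3_eq_3)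
qed

lemma params_of_square_of:
  assumes "p \<in> params s"
  shows "params_of (square_of s p) = p"
  using assms
  by (auto simp: params_def octagon_def square_of_def params_of_def Let_def
        numeral_2_eq_2 numeral_3_eq_3)

text \<open>Each margin of a table contains one of the two opposite cells, so it is at least their
  minimum. Written in terms of the two points, these bounds on \<open>i\<close> and \<open>j\<close>
  are the cuts of the octagon.\<close>

lemma params_of_mem:
  assumes A: "magic_square 4 s A"
  shows "params_of A \<in> params s"
proof -
  note eqs = magic_square_4D(2,3,6,7,10) [OF A] magic_square_4_block_sums [OF A]
  define i j where "i = min (A $$ (0, 1)) (A $$ (3, 2))" and "j = min (A $$ (1, 0)) (A $$ (2, 3))"
  have i: "i \<le> A $$ (0, 1)" "i \<le> A $$ (3, 2)" and j: "j \<le> A $$ (1, 0)" "j \<le> A $$ (2, 3)"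
    by (auto simp: i_def j_def)
  have r: "A $$ (0, 0) + A $$ (3, 3) \<le> s" using eqs(8) by linarith
  have "i \<le> s div 2" using eqs(6) i by linarith
  moreover have "j \<le> s div 2" using eqs(7) j by linarith
  moreover have "(A $$ (0, 0), A $$ (0, 3)) \<in>
      octagon (A $$ (0, 0) + A $$ (3, 3)) (A $$ (0, 3) + A $$ (3, 0)) i j"
    unfolding octagon_def mem_Collect_eq prod.case
  proof (intro conjI)
    show "A $$ (0, 0) \<le> A $$ (0, 0) + A $$ (3, 3)"
      by simp
    show "A $$ (0, 3) \<le> A $$ (0, 3) + A $$ (3, 0)"
      by simp
    show "i \<le> A $$ (0, 0) + A $$ (0, 3)"
      using eqs(1,6) i by linarith
    show "A $$ (0, 0) + A $$ (0, 3) + i \<le> A $$ (0, 0) + A $$ (3, 3) + (A $$ (0, 3) + A $$ (3, 0))"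
      using eqs(1,8) i by linarith
    show "j + A $$ (0, 0) \<le> A $$ (0, 0) + A $$ (3, 3) + A $$ (0, 3)"
      using eqs(3,8) j by linarith
    show "A $$ (0, 3) + j \<le> A $$ (0, 3) + A $$ (3, 0) + A $$ (0, 0)"
      using eqs(3,7) j by linarith
  qed
  moreover have "(A $$ (2, 1), A $$ (1, 1)) \<in>
      octagon (A $$ (0, 0) + A $$ (3, 3)) (A $$ (0, 3) + A $$ (3, 0)) i j"
    unfolding octagon_def mem_Collect_eq prod.case
  proof (intro conjI)
    show "A $$ (2, 1) \<le> A $$ (0, 0) + A $$ (3, 3)"
      using eqs(5,9) by linarith
    show "A $$ (1, 1) \<le> A $$ (0, 3) + A $$ (3, 0)"
      using eqs(5,8) by linarith
    show "i \<le> A $$ (2, 1) + A $$ (1, 1)"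
      using eqs(4,6) i by linarith
    show "A $$ (2, 1) + A $$ (1, 1) + i \<le> A $$ (0, 0) + A $$ (3, 3) + (A $$ (0, 3) + A $$ (3, 0))"
      using eqs(4,8) i by linarith
    show "j + A $$ (2, 1) \<le> A $$ (0, 0) + A $$ (3, 3) + A $$ (1, 1)"
      using eqs(2,5,7,9) j by linarith
    show "A $$ (1, 1) + j \<le> A $$ (0, 3) + A $$ (3, 0) + A $$ (2, 1)"
      using eqs(2,5,8,9) j by linarith
  qed
  moreover have "s - (A $$ (0, 0) + A $$ (3, 3)) = A $$ (0, 3) + A $$ (3, 0)"
    by (rule diff_eqI) (use eqs(8) in linarith)
  ultimately show ?thesis
    using r unfolding params_of_def params_def i_def [symmetric] j_def [symmetric] by simp
qed

lemma square_of_mem: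
  assumes "p \<in> params s"
  shows "magic_square 4 s (square_of s p)"
proof -
  obtain r i j x y x' y' where p: "p = (r, i, j, (x, y), (x', y'))"
    by (metis prod.collapse)
  have h: "r \<le> s" "x \<le> r" "x' \<le> r" "y + r \<le> s" "y' + r \<le> s"
    "i \<le> x + y" "i \<le> x' + y'" "x + y + i \<le> s" "x' + y' + i \<le> s"
    "j + x \<le> r + y" "j + x' \<le> r + y'" "y + j + r \<le> s + x" "y' + j + r \<le> s + x'"
    using assms by (auto simp: p params_def octagon_def)
  define d d' where "d = s - (x + y + x' + y')" and "d' = x + y + x' + y' - s"
  have d: "s + d' = x + y + x' + y' + d" "d = 0 \<or> d' = 0" by (auto simp: d_def d'_def)
  define e e' where "e = y + x' - (x + y')" and "e' = x + y' - (y + x')"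
  have e: "y + x' + e' = x + y' + e" "e = 0 \<or> e' = 0" by (auto simp: e_def e'_def)
  \<comment> \<open>The second equation of each pair records that the subtraction is exact. For a
    table cell outside the opposite pair, one member of that pair equals \<open>i\<close> (or
    \<open>j\<close>) and shares a margin with the cell, so the octagon inequality for that margin
    makes the cell nonnegative.\<close>
  obtain a02 where a02: "a02 = s - (x + y + (i + d))" "x + y + (i + d) + a02 = s"
    using h d by (intro that [OF refl]) linarith
  obtain a12 where a12: "a12 = r - x'" "a12 + x' = r"
    using h by (intro that [OF refl]) linarith
  obtain a13 where a13: "a13 = s + x' - (r + y' + (j + e))" "a13 + (r + y' + (j + e)) = s + x'"
    using h e by (intro that [OF refl]) linarith
  obtain a20 where a20: "a20 = r + y - (x + (j + e))" "a20 + (x + (j + e)) = r + y"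
    using h e by (intro that [OF refl]) linarith
  obtain a22 where a22: "a22 = s - (r + y')" "a22 + (r + y') = s"
    using h by (intro that [OF refl]) linarith
  obtain a30 where a30: "a30 = s - (r + y)" "a30 + (r + y) = s"
    using h by (intro that [OF refl]) linarith
  obtain a31 where a31: "a31 = s - (x' + y' + (i + d))" "a31 + (x' + y' + (i + d)) = s"
    using h d by (intro that [OF refl]) linarith
  obtain a33 where a33: "a33 = r - x" "a33 + x = r"
    using h by (intro that [OF refl]) linarith
  have "square_of s p = mat 4 4 (\<lambda>(k, l).
      [[x, i + d, a02, y], [j + e, y', a12, a13], [a20, x', a22, j + e'],
       [a30, a31, i + d', a33]] ! k ! l)"
    unfolding p square_of_def prod.case Let_def
    by (simp only: a02(1) a12(1) a13(1) a20(1) a22(1) a30(1) a31(1) a33(1)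
        d_def d'_def e_def e'_def)
  moreover have
    "x + (i + d) + a02 + y = s" "(j + e) + y' + a12 + a13 = s"
    "a20 + x' + a22 + (j + e') = s" "a30 + a31 + (i + d') + a33 = s"
    "x + (j + e) + a20 + a30 = s" "(i + d) + y' + x' + a31 = s"
    "a02 + a12 + a22 + (i + d') = s" "y + a13 + (j + e') + a33 = s"
    "x + y' + a22 + a33 = s" "y + a12 + x' + a30 = s"
    using d(1) e(1) a02(2) a12(2) a13(2) a20(2) a22(2) a30(2) a31(2) a33(2) by linarith+
  ultimately show ?thesis
    unfolding magic_square_4_iff
    by (simp add: numeral_2_eq_2 numeral_3_eq_3)
qed

section \<open>The count\<close>

lemma bij_betw_params: "bij_betw params_of {A. magic_square 4 s A} (params s)"
  by (rule bij_betw_byWitness [where f' = "square_of s"])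
     (auto simp: square_of_params_of params_of_square_of params_of_mem square_of_mem)

text \<open>For fixed \<open>r\<close>, \<open>i\<close> and \<open>j\<close> both points range
  independently over the same octagon, which gives the square in \<open>slice\<close>.\<close>

lemma magic_count_4_eq_sum_slice: "magic_count 4 s = (\<Sum>r\<le>s. slice r (s - r))"
proof -
  have "magic_count 4 s = card (params s)"
    unfolding magic_count_def by (rule bij_betw_same_card [OF bij_betw_params])
  also have "\<dots> = (\<Sum>r\<le>s. slice r (s - r))"
    by (simp add: params_def slice_def card_SigmaI card_cartesian_product power2_eq_square)
  finally show ?thesis .
qed

theorem theorem1p1p1:
  fixes s :: nat
  shows "real (magic_count 4 s) =
    (if odd s
     then 1/480 * real s ^ 7 + 7/240 * real s ^ 6 + 89/480 * real s ^ 5 + 11/16 * real s ^ 4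
          + 779/480 * real s ^ 3 + 593/240 * real s ^ 2 + 1051/480 * real s + 13/16
     else 1/480 * real s ^ 7 + 7/240 * real s ^ 6 + 89/480 * real s ^ 5 + 11/16 * real s ^ 4
          + 49/30 * real s ^ 3 + 38/15 * real s ^ 2 + 71/30 * real s + 1)"
proof (cases "odd s")
  case True
  then obtain n where n: "s = 2 * n + 1" by (auto elim: oddE)
  show ?thesis
    using sum_slice_odd [of n] by (simp add: n magic_count_4_eq_sum_slice del: sum.atMost_Suc)
next
  case False
  then obtain n where n: "s = 2 * n" by auto
  show ?thesis
    using sum_slice_even [of n] by (simp add: n magic_count_4_eq_sum_slice del: sum.atMost_Suc)
qed

end
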